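(* Let $\overline{\mathcal T}=(\overline t_1,\dots,\overline t_N)$ be the switching times of a nominal bang-bang control $\overline u$ on $[0,t_f]$, with trajectory $\overline x(\cdot)$ satisfying $\overline x(t_f)=x_f$. Let $t\in[0,t_f]$, and let $x_{per}(t)=\overline x(t)+\delta x(t)$ be a perturbed point. Consider the problem of finding, at time $t$, switching times $\mathcal T=(t_1,\dots,t_N)$ (only those later than $t$ matter) such that $$\tilde E(t,t_1,\dots,t_N)=x_{per}(t),$$ where $\tilde E$ is the backward end-point mapping. At order one in $\delta x$, the solution of minimal norm of this problem is given by $\overline{\mathcal T}+\delta\mathcal T$, with $$\delta\mathcal T=d\tilde E(t,\overline{\mathcal T})^{\dagger}\cdot\delta x(t),$$ where $d\tilde E(t,\overline{\mathcal T})^{\dagger}$ denotes the (Moore–Penrose) pseudo-inverse of $d\tilde E(t,\overline{\mathcal T})$. Moreover, we have the estimate $$\|\delta\mathcal T\|_2\le\frac{1}{\sigma_{\min}(t)}\,\|\delta x(t)\|_2,$$ where $\sigma_{\min}(t)$ is the smallest positive singular value of $d\tilde E(t,\overline{\mathcal T})$.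
   Context: Setting: $f:\mathbb{R}\times\mathbb{R}^n\times\mathbb{R}^m\to\mathbb{R}^n$ is smooth and the control system is $\dot x(t)=f(t,x(t),u(t))$ with $u\in L^\infty([0,t_f];\Omega)$, $\Omega=[a_1,b_1]\times\cdots\times[a_m,b_m]$. Controls are bang-bang with finitely many switchings: $u_i(t)\in\{a_i,b_i\}$ for a.e. $t$ and every $i$, with switching times $0<t_1<\cdots<t_N<t_f$, one and only one component (index $i_j$) switching at $t_j$. With the initial values of the components, the indices $(i_1,\dots,i_N)$ and $t_f$ fixed, a control is identified with its vector of switching times $\mathcal T=(t_1,\dots,t_N)$. Nominal trajectory: $\overline x(\cdot)$ is the solution on $[0,t_f]$ of the control system associated with the control $\overline u$ represented by $\overline{\mathcal T}$, and $\overline x(t_f)=x_f$. When $\overline u$ is applied in practice, perturbations lead to an observed trajectory $x_{per}(t)=\overline x(t)+\delta x(t)$. Backward end-point mapping: for a bang-bang control $u$ with switching times $(t_1,\dots,t_N)$ and $t\in[0,t_f]$, $\tilde E(t,t_1,\dots,t_N)=\tilde x(t_f-t)$, where $\tilde x(\cdot)$ is the solution of $\dot{\tilde x}(s)=-f(t_f-s,\tilde x(s),u(t_f-s))$, $\tilde x(0)=x_f$. In particular $\tilde E(t,\overline{\mathcal T})=\overline x(t)$. Differential: for given $t$, let $j$ be the smallest index with $\overline t_j>t$ (with the convention $j=N+1$ if $t>\overline t_N$). The times $\overline t_1,\dots,\overline t_{j-1}$ play no role in $\tilde E(t,\overline{\mathcal T})$, and the unknowns at time $t$ are $(t_j,\dots,t_N)$.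 The map $\tilde E(t,\cdot)$ is differentiable with respect to the switching times, and $d\tilde E(t,\overline{\mathcal T})$ denotes its differential at $\overline{\mathcal T}$, a real $n\times(N-j+1)$ matrix. "At order one" means that the equation $\tilde E(t,\overline{\mathcal T}+\delta\mathcal T)=x_{per}(t)$ is replaced by its linearization at $\overline{\mathcal T}$, namely $d\tilde E(t,\overline{\mathcal T})\cdot\delta\mathcal T=\delta x(t)$. The norm $\|\cdot\|_2$ is the Euclidean norm. *)

theory Defs
  imports "HOL-Analysis.Analysis" "Jordan_Normal_Form.Char_Poly"
begin

unbundle no vec_syntax  (* \<open>$\<close> is indexing of \<open>'a vec\<close>; components in \<open>real ^ 'n\<close> are written with \<open>vec_nth\<close> *)

subsection \<open>Control system\<close>

primrec of_class_C :: "nat \<Rightarrow> ('a::euclidean_space \<Rightarrow> 'b::euclidean_space) \<Rightarrow> bool" where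
  "of_class_C 0 g \<longleftrightarrow> continuous_on UNIV g"
| "of_class_C (Suc k) g \<longleftrightarrow>
     (\<forall>x. g differentiable (at x)) \<and> (\<forall>v. of_class_C k (\<lambda>x. frechet_derivative g (at x) v))"

definition smooth :: "('a::euclidean_space \<Rightarrow> 'b::euclidean_space) \<Rightarrow> bool" where
  "smooth g \<longleftrightarrow> (\<forall>k. of_class_C k g)"

text \<open>Solutions of \<open>x' = g(s, x)\<close> on \<open>[0, r]\<close> for a right-hand side that is discontinuous in time
  (absolutely continuous solutions, in integral form).\<close>

definition ode_solution ::
    "(real \<Rightarrow> 'a::euclidean_space \<Rightarrow> 'a) \<Rightarrow> real \<Rightarrow> (real \<Rightarrow> 'a) \<Rightarrow> bool" where
  "ode_solution g r x \<longleftrightarrow> continuous_on {0..r} x \<and>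
     (\<forall>s\<in>{0..r}. ((\<lambda>\<tau>. g \<tau> (x \<tau>)) has_integral (x s - x 0)) {0..s})"

text \<open>Switching times are zero-based: the entry \<open>T $ k\<close> is the time at which the component
  \<open>idx k\<close> switches, for \<open>k < dim_vec T\<close>.\<close>

definition switching_times :: "real \<Rightarrow> nat \<Rightarrow> real vec \<Rightarrow> bool" where
  "switching_times tf N T \<longleftrightarrow> T \<in> carrier_vec N \<and> (\<forall>k<N. 0 < T $ k \<and> T $ k < tf) \<and>
     (\<forall>k l. k < l \<longrightarrow> l < N \<longrightarrow> T $ k < T $ l)"

text \<open>The control with initial value \<open>u0\<close> (a vertex of the box): component \<open>i\<close> has its initial value
  after an even number of switchings and the other endpoint after an odd number.\<close>

definition bang_bang_control ::
    "real^'m \<Rightarrow> real^'m \<Rightarrow> real^'m \<Rightarrow> (nat \<Rightarrow> 'm) \<Rightarrow> real vec \<Rightarrow> real \<Rightarrow> real^'m" where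
  "bang_bang_control a b u0 idx T s = vec_lambda (\<lambda>i.
     if even (card {k. k < dim_vec T \<and> idx k = i \<and> T $ k \<le> s}) then vec_nth u0 i
     else if vec_nth u0 i = vec_nth a i then vec_nth b i else vec_nth a i)"

text \<open>The value \<open>x(t\<^sub>f - t)\<close> of the backward solution issued from \<open>xf\<close>; only its restriction
  to \<open>[0, t\<^sub>f - t]\<close> matters.\<close>

definition backward_endpoint ::
    "(real \<times> (real^'n) \<times> (real^'m) \<Rightarrow> real^'n) \<Rightarrow> real^'m \<Rightarrow> real^'m \<Rightarrow> real^'m \<Rightarrow> (nat \<Rightarrow> 'm) \<Rightarrow>
     real \<Rightarrow> real^'n \<Rightarrow> real \<Rightarrow> real vec \<Rightarrow> real^'n" where
  "backward_endpoint f a b u0 idx tf xf t T = (THE p. \<exists>y.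
     ode_solution (\<lambda>s z. - f (tf - s, z, bang_bang_control a b u0 idx T (tf - s))) (tf - t) y \<and>
     y 0 = xf \<and> y (tf - t) = p)"

subsection \<open>Vectors and matrices of variable size\<close>

definition vnorm :: "real vec \<Rightarrow> real" where
  "vnorm v = sqrt (scalar_prod v v)"

text \<open>Coordinates of a state, in a fixed enumeration of the index type.\<close>

definition coords :: "real^'n \<Rightarrow> real vec" where
  "coords x = Matrix.vec CARD('n) (\<lambda>i. vec_nth x (from_nat_into UNIV i))"

definition has_differential :: "(real vec \<Rightarrow> real^'n) \<Rightarrow> real vec \<Rightarrow> real mat \<Rightarrow> bool" where
  "has_differential F w D \<longleftrightarrow> D \<in> carrier_mat CARD('n) (dim_vec w) \<and>
     (\<forall>e>0. \<exists>d>0. \<forall>h\<in>carrier_vec (dim_vec w). vnorm h < d \<longrightarrow>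
        vnorm (coords (F (w + h) - F w) - D *\<^sub>v h) \<le> e * vnorm h)"

text \<open>Total version: zero where the map is not differentiable.\<close>

definition differential :: "(real vec \<Rightarrow> real^'n) \<Rightarrow> real vec \<Rightarrow> real mat" where
  "differential F w =
     (if \<exists>D. has_differential F w D then THE D. has_differential F w D
      else 0\<^sub>m CARD('n) (dim_vec w))"

definition is_pseudo_inverse :: "real mat \<Rightarrow> real mat \<Rightarrow> bool" where
  "is_pseudo_inverse A X \<longleftrightarrow> X \<in> carrier_mat (dim_col A) (dim_row A) \<and>
     A * X * A = A \<and> X * A * X = X \<and>
     transpose_mat (A * X) = A * X \<and> transpose_mat (X * A) = X * A"

definition pseudo_inverse :: "real mat \<Rightarrow> real mat" where
  "pseudo_inverse A = (THE X. is_pseudo_inverse A X)"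

definition singular_value :: "real mat \<Rightarrow> real \<Rightarrow> bool" where
  "singular_value A s \<longleftrightarrow> 0 \<le> s \<and> eigenvalue (transpose_mat A * A) (s\<^sup>2)"

definition positive_singular_values :: "real mat \<Rightarrow> real set" where
  "positive_singular_values A = {s. 0 < s \<and> singular_value A s}"

text \<open>Meaningful only if \<open>positive_singular_values A \<noteq> {}\<close>, i.e. if \<open>A\<close> is not zero.\<close>

definition sigma_min :: "real mat \<Rightarrow> real" where
  "sigma_min A = Min (positive_singular_values A)"

definition solutions :: "real mat \<Rightarrow> real vec \<Rightarrow> real vec set" where
  "solutions A y = {v \<in> carrier_vec (dim_col A). A *\<^sub>v v = y}"

definition least_squares_solutions :: "real mat \<Rightarrow> real vec \<Rightarrow> real vec set" where
  "least_squares_solutions A y = {v \<in> carrier_vec (dim_col A).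
     \<forall>w\<in>carrier_vec (dim_col A). vnorm (A *\<^sub>v v - y) \<le> vnorm (A *\<^sub>v w - y)}"

text \<open>\<open>v\<close> is the unique element of least norm of \<open>S\<close>.\<close>

definition minimal_norm_element :: "real vec set \<Rightarrow> real vec \<Rightarrow> bool" where
  "minimal_norm_element S v \<longleftrightarrow> v \<in> S \<and> (\<forall>w\<in>S. w \<noteq> v \<longrightarrow> vnorm v < vnorm w)"

subsection \<open>Differential of the backward end-point mapping\<close>

text \<open>Zero-based index of the first switching time after \<open>t\<close>; equal to \<open>dim_vec T\<close> if there is none.
  It is also the number of switching times that are not unknowns at time \<open>t\<close>.\<close>

definition first_after :: "real \<Rightarrow> real vec \<Rightarrow> nat" where
  "first_after t T = (LEAST k. k < dim_vec T \<longrightarrow> t < T $ k)"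

text \<open>The differential is taken with respect to the switching times later than \<open>t\<close> only, the
  earlier ones being kept fixed: it has \<open>dim_vec T - first_after t T\<close> columns.\<close>

definition d_backward_endpoint ::
    "(real \<times> (real^'n) \<times> (real^'m) \<Rightarrow> real^'n) \<Rightarrow> real^'m \<Rightarrow> real^'m \<Rightarrow> real^'m \<Rightarrow> (nat \<Rightarrow> 'm) \<Rightarrow>
     real \<Rightarrow> real^'n \<Rightarrow> real \<Rightarrow> real vec \<Rightarrow> real mat" where
  "d_backward_endpoint f a b u0 idx tf xf t T =
     differential (\<lambda>h. backward_endpoint f a b u0 idx tf xf t (T + (0\<^sub>v (first_after t T) @\<^sub>v h)))
       (0\<^sub>v (dim_vec T - first_after t T))"

end

(* Since "differential" is total and differentials are unique, D is always a matrix of the right size,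
   and the rest is linear algebra for an arbitrary real matrix A with pseudo-inverse X.
   Existence of X: a generalized inverse of A^T A, read off the row echelon form, gives X1 with
   A X1 A = A and A X1 symmetric; the same for A^T gives X2 with A X2 A = A and X2 A symmetric;
   then X = X2 A X1. Minimality of v = X y is Pythagoras twice: A v - y is orthogonal to the range of A,
   and v is orthogonal to the kernel. For the estimate, v lies in the row space of A, where
   |A v| >= sigma_min |v|: the minimum of |A u| over the unit vectors of the row space is attained
   and is a positive singular value of A. *)

theory Submission
  imports Defs
begin

unbundle no inner_syntax

section \<open>Matrix products and the Euclidean norm of vectors of variable size\<close>

text \<open>Premises are equations between dimensions, which simplification can discharge without
  guessing sizes; the next two lemmas follow the same pattern.\<close>

lemma mult_mat_assoc:
  "dim_col A = dim_row B \<Longrightarrow> dim_col B = dim_row C \<Longrightarrow> A * B * C = A * (B * C)"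
  for A :: "'a::semiring_0 mat"
  by (rule assoc_mult_mat) auto

lemma mult_mat_vec_assoc:
  "dim_col A = dim_row B \<Longrightarrow> dim_col B = dim_vec v \<Longrightarrow> (A * B) *\<^sub>v v = A *\<^sub>v (B *\<^sub>v v)"
  for A :: "'a::semiring_0 mat"
  by (rule assoc_mult_mat_vec) auto

lemma transpose_mult_mat:
  "dim_col A = dim_row B \<Longrightarrow> transpose_mat (A * B) = transpose_mat B * transpose_mat A"
  for A :: "'a::comm_semiring_0 mat"
  by (rule transpose_mult) auto

lemma scalar_prod_transpose:
  fixes A :: "'a::comm_semiring_0 mat"
  assumes "v \<in> carrier_vec (dim_col A)" "w \<in> carrier_vec (dim_row A)"
  shows "(A *\<^sub>v v) \<bullet> w = v \<bullet> (transpose_mat A *\<^sub>v w)"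
proof -
  have "(A *\<^sub>v v) \<bullet> w = (\<Sum>i<dim_row A. \<Sum>j<dim_col A. A $$ (i,j) * v $ j * w $ i)"
    using assms by (simp add: scalar_prod_def sum_distrib_right atLeast0LessThan)
  also have "\<dots> = (\<Sum>j<dim_col A. \<Sum>i<dim_row A. A $$ (i,j) * v $ j * w $ i)"
    by (rule sum.swap)
  also have "\<dots> = v \<bullet> (transpose_mat A *\<^sub>v w)"
    using assms by (simp add: scalar_prod_def sum_distrib_left atLeast0LessThan mult_ac)
  finally show ?thesis .
qed

lemma vnorm_eq_L2_set: "vnorm v = L2_set (\<lambda>i. v $ i) {..<dim_vec v}"
  by (simp add: vnorm_def L2_set_def scalar_prod_def power2_eq_square atLeast0LessThan)

lemma vnorm_nonneg: "0 \<le> vnorm v"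
  by (simp add: vnorm_eq_L2_set)

lemma vnorm_power2: "(vnorm v)\<^sup>2 = v \<bullet> v"
  by (simp add: vnorm_def scalar_prod_def sum_nonneg)

lemma vnorm_eq_0_iff: "vnorm v = 0 \<longleftrightarrow> v = 0\<^sub>v (dim_vec v)"
  by (auto simp: vnorm_eq_L2_set L2_set_eq_0_iff vec_eq_iff)

lemma vnorm_minus_eq_0_iff:
  assumes "v \<in> carrier_vec n" "w \<in> carrier_vec n"
  shows "vnorm (v - w) = 0 \<longleftrightarrow> v = w"
proof
  assume "vnorm (v - w) = 0"
  then have "v - w = 0\<^sub>v n" using assms by (simp add: vnorm_eq_0_iff)
  then have "(v - w) $ i = 0" if "i < n" for i using that by simp
  then show "v = w" using assms by (intro eq_vecI) auto
qed (use assms in \<open>simp add: vnorm_eq_0_iff\<close>)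

lemma vnorm_zero_vec: "vnorm (0\<^sub>v n) = 0"
  by (simp add: vnorm_eq_0_iff)

lemma vnorm_triangle:
  assumes "dim_vec v = dim_vec w"
  shows "vnorm (v + w) \<le> vnorm v + vnorm w"
proof -
  have "vnorm (v + w) = L2_set (\<lambda>i. v $ i + w $ i) {..<dim_vec w}"
    unfolding vnorm_eq_L2_set by (auto intro: L2_set_cong)
  also have "\<dots> \<le> vnorm v + vnorm w"
    using L2_set_triangle_ineq[of "\<lambda>i. v $ i" "\<lambda>i. w $ i" "{..<dim_vec w}"] assms
    by (simp add: vnorm_eq_L2_set)
  finally show ?thesis .
qed

lemma vnorm_smult: "vnorm (c \<cdot>\<^sub>v v) = \<bar>c\<bar> * vnorm v"
proof -
  have "(c \<cdot>\<^sub>v v) \<bullet> (c \<cdot>\<^sub>v v) = c\<^sup>2 * (v \<bullet> v)"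
    by (simp add: power2_eq_square)
  then show ?thesis by (simp add: vnorm_def real_sqrt_mult)
qed

text \<open>The scalar \<open>r\<close> is kept free: \<open>r = 1\<close> gives Pythagoras, and a
  variable \<open>r\<close> gives the first variation in \<open>sigma_min_le\<close>.\<close>

lemma vnorm_power2_add_smult:
  assumes "dim_vec v = dim_vec w"
  shows "(vnorm (v + r \<cdot>\<^sub>v w))\<^sup>2 = (vnorm v)\<^sup>2 + 2 * r * (v \<bullet> w) + r\<^sup>2 * (vnorm w)\<^sup>2"
proof -
  have "(v + r \<cdot>\<^sub>v w) \<bullet> (v + r \<cdot>\<^sub>v w) =
      (\<Sum>i<dim_vec w. v $ i * v $ i + 2 * r * (v $ i * w $ i) + r\<^sup>2 * (w $ i * w $ i))"
    using assms by (simp add: scalar_prod_def atLeast0LessThan algebra_simps power2_eq_square)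
  also have "\<dots> = v \<bullet> v + 2 * r * (v \<bullet> w) + r\<^sup>2 * (w \<bullet> w)"
    using assms by (simp add: scalar_prod_def atLeast0LessThan sum.distrib sum_distrib_left)
  finally show ?thesis by (simp add: vnorm_power2)
qed

lemma vnorm_power2_add_orthogonal:
  assumes "dim_vec v = dim_vec w" "v \<bullet> w = 0"
  shows "(vnorm (v + w))\<^sup>2 = (vnorm v)\<^sup>2 + (vnorm w)\<^sup>2"
  using vnorm_power2_add_smult[OF assms(1), of 1] assms(2) by (simp add: one_smult_vec)

text \<open>The enumeration \<open>from_nat_into UNIV\<close> is a bijection onto the finite index
  type, so the sum of squares is merely reindexed.\<close>

lemma vnorm_coords: "vnorm (coords x) = norm x"
  for x :: "real^'n"
proof -
  have b: "bij_betw (from_nat_into (UNIV :: 'n set)) {..<CARD('n)} UNIV"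
    by (rule bij_betw_from_nat_into_finite) simp
  have "(\<Sum>i<CARD('n). (vec_nth x (from_nat_into UNIV i))\<^sup>2) = (\<Sum>i\<in>UNIV. (vec_nth x i)\<^sup>2)"
    by (rule sum.reindex_bij_betw[OF b])
  then show ?thesis
    by (simp add: vnorm_eq_L2_set norm_vec_def L2_set_def coords_def)
qed

lemma coords_carrier: "coords x \<in> carrier_vec CARD('n)" for x :: "real^'n"
  by (simp add: coords_def)

section \<open>Uniqueness and size of the differential\<close>

text \<open>The difference of two linear approximations of the same increment is linear and
  \<open>o(vnorm h)\<close>; following it along multiples of a fixed direction shows that it
  vanishes.\<close>

lemma has_differential_unique:
  fixes F :: "real vec \<Rightarrow> real^'n"
  assumes D: "has_differential F w D" and E: "has_differential F w E"
  shows "D = E"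
proof -
  let ?k = "dim_vec w"
  have DC: "D \<in> carrier_mat CARD('n) ?k" and EC: "E \<in> carrier_mat CARD('n) ?k"
    using D E by (auto simp: has_differential_def)
  have zero: "vnorm ((D - E) *\<^sub>v u) = 0" if u: "u \<in> carrier_vec ?k" for u
  proof (rule ccontr)
    assume "vnorm ((D - E) *\<^sub>v u) \<noteq> 0"
    then have pos: "0 < vnorm ((D - E) *\<^sub>v u)" (is "0 < ?c") using vnorm_nonneg[of "(D - E) *\<^sub>v u"] by simp
    \<comment> \<open>Adding 1 gives a positive divisor without a separate proof that
      \<open>u\<close> is nonzero.\<close>
    define q where "q = vnorm u + 1"
    have q: "0 < q" "vnorm u \<le> q" using vnorm_nonneg[of u] by (simp_all add: q_def)
    \<comment> \<open>The errors of \<open>D\<close> and \<open>E\<close> then add up, after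
      division by \<open>r\<close>, to at most \<open>2 * e * q = ?c / 2\<close>, which contradicts
      \<open>0 < ?c\<close>.\<close>
    define e where "e = ?c / (4 * q)"
    have "0 < e" unfolding e_def using pos q by simp
    then obtain d1 d2 where d: "0 < d1" "0 < d2"
      and D1: "\<And>h. h \<in> carrier_vec ?k \<Longrightarrow> vnorm h < d1 \<Longrightarrow> vnorm (coords (F (w + h) - F w) - D *\<^sub>v h) \<le> e * vnorm h"
      and E1: "\<And>h. h \<in> carrier_vec ?k \<Longrightarrow> vnorm h < d2 \<Longrightarrow> vnorm (coords (F (w + h) - F w) - E *\<^sub>v h) \<le> e * vnorm h"
      using D E unfolding has_differential_def by metis
    define r where "r = min d1 d2 / (2 * q)"
    have r: "0 < r" unfolding r_def using d q by simp
    have "r * vnorm u \<le> r * q" using r q by simp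
    also have "\<dots> = min d1 d2 / 2" unfolding r_def using q by simp
    also have "\<dots> < min d1 d2" using d by (simp add: min_def)
    finally have small: "vnorm (r \<cdot>\<^sub>v u) < d1" "vnorm (r \<cdot>\<^sub>v u) < d2"
      using r by (simp_all add: vnorm_smult)
    let ?h = "r \<cdot>\<^sub>v u" and ?g = "coords (F (w + r \<cdot>\<^sub>v u) - F w)"
    have h: "?h \<in> carrier_vec ?k" using u by simp
    have g: "?g \<in> carrier_vec CARD('n)" by (rule coords_carrier)
    have "r * ?c = vnorm ((D - E) *\<^sub>v ?h)"
      using r by (simp add: mult_mat_vec[OF minus_carrier_mat[OF EC] u] vnorm_smult)
    \<comment> \<open>The increment \<open>?g\<close> of \<open>F\<close> is inserted; the
      difference is written as a sum so that the triangle inequality applies.\<close>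
    also have "(D - E) *\<^sub>v ?h = (?g - E *\<^sub>v ?h) + (-1) \<cdot>\<^sub>v (?g - D *\<^sub>v ?h)"
      using DC EC h g by (intro eq_vecI) (auto simp: minus_mult_distrib_mat_vec[OF DC EC h])
    also have "vnorm \<dots> \<le> vnorm (?g - E *\<^sub>v ?h) + vnorm ((-1) \<cdot>\<^sub>v (?g - D *\<^sub>v ?h))"
      using DC EC by (intro vnorm_triangle) auto
    also have "\<dots> \<le> e * vnorm ?h + e * vnorm ?h"
      using D1[OF h small(1)] E1[OF h small(2)] by (simp only: vnorm_smult)
    also have "\<dots> = r * (2 * e * vnorm u)" using r by (simp add: vnorm_smult)
    finally have "?c \<le> 2 * e * vnorm u" using r by simp
    also have "\<dots> \<le> 2 * e * q" using \<open>0 < e\<close> q by simp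
    also have "\<dots> = ?c / 2" unfolding e_def using q by simp
    finally show False using pos by simp
  qed
  show ?thesis
  proof (rule eq_matI)
    fix i j assume "i < dim_row E" "j < dim_col E"
    then have ij: "i < CARD('n)" "j < ?k" using EC by auto
    have "(D - E) *\<^sub>v unit_vec ?k j = 0\<^sub>v CARD('n)"
      using zero[of "unit_vec ?k j"] DC EC by (simp add: vnorm_eq_0_iff)
    then have "((D - E) *\<^sub>v unit_vec ?k j) $ i = 0" using ij by simp
    then show "D $$ (i, j) = E $$ (i, j)"
      using ij DC EC by (simp add: scalar_prod_right_unit)
  qed (use DC EC in auto)
qed

text \<open>Both branches of the definition have this size: by uniqueness the description picks an
  actual differential, and the default is a zero matrix of the same size.\<close>

lemma differential_carrier:
  "differential F w \<in> carrier_mat CARD('n) (dim_vec w)"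
  for F :: "real vec \<Rightarrow> real^'n"
proof (cases "\<exists>D. has_differential F w D")
  case True
  then have "\<exists>!D. has_differential F w D" using has_differential_unique by blast
  then have "has_differential F w (differential F w)"
    unfolding differential_def using theI'[of "has_differential F w"] True by simp
  then show ?thesis by (simp add: has_differential_def)
qed (simp add: differential_def)

section \<open>Existence and uniqueness of the pseudo-inverse\<close>

text \<open>Let \<open>E = P * A\<close> be the reduced row echelon form. Sending each row index to
  its pivot column defines \<open>V\<close> such that \<open>E * V\<close> is the diagonal
  projection onto the nonzero rows, so \<open>E * V * E = E\<close>. Since \<open>P\<close> is
  invertible, \<open>V * P\<close> serves as \<open>W\<close>.\<close>

lemma generalized_inverse_exists:
  fixes A :: "'a::field mat"
  obtains W where "W \<in> carrier_mat (dim_col A) (dim_row A)" "A * W * A = A"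
proof -
  let ?n = "dim_row A" and ?m = "dim_col A"
  have A: "A \<in> carrier_mat ?n ?m" by simp
  define E where "E = gauss_jordan_single A"
  note gj = gauss_jordan_single[OF A E_def[symmetric]]
  obtain P Q where EPA: "E = P * A" and P: "P \<in> carrier_mat ?n ?n" and Q: "Q \<in> carrier_mat ?n ?n"
    and QP: "Q * P = 1\<^sub>m ?n" using gj(4) by blast
  have E: "E \<in> carrier_mat ?n ?m" by (rule gj(2))
  obtain f where f: "pivot_fun E f ?m" using gj(3) E by (auto simp: row_echelon_form_def)
  note piv = pivot_funD[OF carrier_matD(1)[OF E] f]
  \<comment> \<open>Column \<open>i\<close> is the unit vector at the pivot position
    \<open>f i\<close>; the value \<open>f i = ?m\<close> marks a row without pivot and gives a zero
    column.\<close>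
  define V where "V = mat ?m ?n (\<lambda>(j, i). if j = f i then (1::'a) else 0)"
  have V: "V \<in> carrier_mat ?m ?n" by (simp add: V_def)
  have EV: "(E * V) $$ (i, l) = (if l = i \<and> f i < ?m then 1 else 0)" if il: "i < ?n" "l < ?n" for i l
  proof -
    have "(E * V) $$ (i, l) = (\<Sum>j<?m. if j = f l then E $$ (i, j) else 0)"
      using E il unfolding V_def
      by (simp add: scalar_prod_def atLeast0LessThan if_distrib[of "(*) _"] cong: if_cong)
    also have "\<dots> = (if f l < ?m then E $$ (i, f l) else 0)" by simp
    \<comment> \<open>A pivot equals 1 and is the only nonzero entry of its column.\<close>
    also have "\<dots> = (if l = i \<and> f i < ?m then 1 else 0)"
      using piv(4)[OF il(2)] piv(5)[OF il(2) _ il(1)] by auto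
    finally show ?thesis .
  qed
  have EVE: "E * V * E = E"
  proof (rule eq_matI)
    fix i j assume "i < dim_row E" "j < dim_col E"
    then have ij: "i < ?n" "j < ?m" using E by auto
    have "(E * V * E) $$ (i, j) = (\<Sum>l<?n. (E * V) $$ (i, l) * E $$ (l, j))"
      using E V ij by (simp add: scalar_prod_def atLeast0LessThan del: assoc_mult_mat)
    also have "\<dots> = (\<Sum>l<?n. if l = i then (if f i < ?m then E $$ (i, j) else 0) else 0)"
      using ij by (intro sum.cong) (auto simp: EV)
    \<comment> \<open>If \<open>f i = ?m\<close>, every entry of row \<open>i\<close> lies to the
      left of \<open>f i\<close> and is therefore zero.\<close>
    also have "\<dots> = E $$ (i, j)"
      using ij piv(1)[OF ij(1)] piv(2)[OF ij(1), of j] by auto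
    finally show "(E * V * E) $$ (i, j) = E $$ (i, j)" .
  qed (use E in auto)
  have "A = Q * E" using P Q QP by (simp add: EPA mult_mat_assoc[symmetric])
  have "A * (V * P) * A = Q * E * (V * P) * A"
    by (rule arg_cong[OF \<open>A = Q * E\<close>, of "\<lambda>B. B * (V * P) * A"])
  also have "\<dots> = Q * (E * V * E)"
    using P Q V E by (simp add: EPA[symmetric] mult_mat_assoc)
  also have "\<dots> = A" using EVE \<open>A = Q * E\<close> by simp
  finally show ?thesis using that[of "V * P"] V P by auto
qed

text \<open>With \<open>Z = A * Y\<close>, the hypothesis makes \<open>transpose_mat Z * Z\<close>
  zero, and its diagonal entries are the squared norms of the columns of \<open>Z\<close>. This
  allows \<open>transpose_mat A\<close> to be cancelled on the left.\<close>

lemma mult_mat_eq_0_if_gram: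
  fixes A Y :: "real mat"
  assumes "dim_col A = dim_row Y" "transpose_mat A * (A * Y) = 0\<^sub>m (dim_col A) (dim_col Y)"
  shows "A * Y = 0\<^sub>m (dim_row A) (dim_col Y)"
proof (rule eq_matI)
  let ?Z = "A * Y"
  fix i j assume "i < dim_row (0\<^sub>m (dim_row A) (dim_col Y))" "j < dim_col (0\<^sub>m (dim_row A) (dim_col Y))"
  then have ij: "i < dim_row A" "j < dim_col Y" by auto
  have "transpose_mat ?Z * ?Z = transpose_mat Y * (transpose_mat A * ?Z)"
    using assms(1) by (simp add: transpose_mult_mat mult_mat_assoc)
  also have "\<dots> = 0\<^sub>m (dim_col Y) (dim_col Y)" using assms by (simp add: right_mult_zero_mat[of _ _ "dim_col A"])
  finally have "(transpose_mat ?Z * ?Z) $$ (j, j) = 0" using ij by simp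
  then have "(vnorm (col ?Z j))\<^sup>2 = 0" using ij by (simp add: vnorm_power2 del: col_mult2)
  then have "col ?Z j = 0\<^sub>v (dim_row A)" by (simp add: vnorm_eq_0_iff)
  then have "col ?Z j $ i = 0" using ij by simp
  then show "?Z $$ (i, j) = 0\<^sub>m (dim_row A) (dim_col Y) $$ (i, j)" using ij by simp
qed auto

text \<open>The witness is \<open>G * transpose_mat A\<close>, with \<open>G\<close> a symmetric
  generalized inverse of the Gram matrix \<open>B\<close>: symmetry of \<open>G\<close> passes to
  \<open>A * G * transpose_mat A\<close>, and cancelling \<open>transpose_mat A\<close> in
  \<open>B * G * B = B\<close> leaves \<open>A * G * B = A\<close>.\<close>

lemma least_squares_inverse_exists:
  fixes A :: "real mat"
  obtains X where "X \<in> carrier_mat (dim_col A) (dim_row A)" "A * X * A = A"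
    "transpose_mat (A * X) = A * X"
proof -
  define B where "B = transpose_mat A * A"
  have dimB [simp]: "dim_row B = dim_col A" "dim_col B = dim_col A" by (simp_all add: B_def)
  have symB: "transpose_mat B = B" by (simp add: B_def transpose_mult_mat)
  obtain W where W: "W \<in> carrier_mat (dim_col A) (dim_col A)" and BWB: "B * W * B = B"
    using generalized_inverse_exists[of B] by auto
  have [simp]: "dim_row W = dim_col A" "dim_col W = dim_col A" using W by auto
  \<comment> \<open>\<open>W\<close> may fail to be symmetric; this product is symmetric and remains
    a generalized inverse, because transposing \<open>B * W * B = B\<close> gives the same equation
    for \<open>transpose_mat W\<close>.\<close>
  define G where "G = W * B * transpose_mat W"
  have [simp]: "dim_row G = dim_col A" "dim_col G = dim_col A" by (simp_all add: G_def)
  have symG: "transpose_mat G = G" by (simp add: G_def transpose_mult_mat mult_mat_assoc symB)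
  have "B * transpose_mat W * B = transpose_mat (B * W * B)"
    by (simp add: transpose_mult_mat mult_mat_assoc symB)
  then have BWtB: "B * transpose_mat W * B = B" by (simp only: BWB symB)
  have "B * G * B = (B * W * B) * transpose_mat W * B" by (simp add: G_def mult_mat_assoc)
  then have BGB: "B * G * B = B" by (simp only: BWB BWtB)
  let ?Y = "G * B - 1\<^sub>m (dim_col A)"
  have AY: "A * ?Y = A * (G * B) - A"
    by (subst mult_minus_distrib_mat[of _ "dim_row A" "dim_col A" _ "dim_col A"]) auto
  have "transpose_mat A * (A * ?Y) = transpose_mat A * (A * (G * B)) - B"
    unfolding AY B_def[symmetric]
    by (subst mult_minus_distrib_mat[of _ "dim_col A" "dim_row A" _ "dim_col A"]) (auto simp: B_def)
  also have "transpose_mat A * (A * (G * B)) = B * G * B" by (simp add: B_def mult_mat_assoc)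
  also have "B * G * B - B = 0\<^sub>m (dim_col A) (dim_col A)" unfolding BGB by (rule eq_matI) auto
  finally have "A * ?Y = 0\<^sub>m (dim_row A) (dim_col A)"
    using mult_mat_eq_0_if_gram[of A ?Y] by simp
  then have Z: "A * (G * B) - A = 0\<^sub>m (dim_row A) (dim_col A)" by (simp only: AY)
  have AGB: "A * (G * B) = A"
  proof (rule eq_matI)
    fix i j assume ij: "i < dim_row A" "j < dim_col A"
    have "(A * (G * B) - A) $$ (i, j) = 0" unfolding Z using ij by simp
    then show "(A * (G * B)) $$ (i, j) = A $$ (i, j)" using ij by (subst (asm) index_minus_mat) auto
  qed auto
  show ?thesis
  proof (rule that[of "G * transpose_mat A"])
    show "A * (G * transpose_mat A) * A = A"
      using AGB by (simp add: mult_mat_assoc B_def)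
    show "transpose_mat (A * (G * transpose_mat A)) = A * (G * transpose_mat A)"
      by (simp add: transpose_mult_mat mult_mat_assoc symG)
  qed (auto intro: carrier_matI)
qed

text \<open>In \<open>Z * A * X\<close>, multiplication by \<open>A\<close> on the left absorbs
  \<open>Z * A\<close>, and on the right absorbs \<open>A * X\<close>. The products are thus
  \<open>A * X\<close> and \<open>Z * A\<close>, which are symmetric by the choice of
  \<open>X\<close> and \<open>Z\<close>.\<close>

lemma pseudo_inverse_exists: "\<exists>X. is_pseudo_inverse A X"
proof -
  obtain X where X: "X \<in> carrier_mat (dim_col A) (dim_row A)" and AXA: "A * X * A = A"
    and symAX: "transpose_mat (A * X) = A * X"
    by (rule least_squares_inverse_exists)
  obtain Y where Y: "Y \<in> carrier_mat (dim_row A) (dim_col A)"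
    and AYA: "transpose_mat A * Y * transpose_mat A = transpose_mat A"
    and symAY: "transpose_mat (transpose_mat A * Y) = transpose_mat A * Y"
    using least_squares_inverse_exists[of "transpose_mat A"] by auto
  define Z where "Z = transpose_mat Y"
  have [simp]: "dim_row X = dim_col A" "dim_col X = dim_row A" "dim_row Z = dim_col A" "dim_col Z = dim_row A"
    "dim_row Y = dim_row A" "dim_col Y = dim_col A"
    using X Y by (auto simp: Z_def)
  have "A * Z * A = transpose_mat (transpose_mat A * Y * transpose_mat A)"
    by (simp add: Z_def transpose_mult_mat mult_mat_assoc)
  then have AZA: "A * Z * A = A" by (simp add: AYA)
  have symZA: "transpose_mat (Z * A) = Z * A"
    using symAY by (simp add: Z_def transpose_mult_mat)
  let ?X = "Z * A * X"
  have l: "A * ?X = A * X"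
  proof -
    have "A * ?X = (A * Z * A) * X" by (simp add: mult_mat_assoc)
    then show ?thesis by (simp only: AZA)
  qed
  have r: "?X * A = Z * A"
  proof -
    have "?X * A = Z * (A * X * A)" by (simp add: mult_mat_assoc)
    then show ?thesis by (simp only: AXA)
  qed
  have "?X * A * ?X = Z * (A * ?X)" unfolding r by (simp add: mult_mat_assoc)
  also have "\<dots> = ?X" unfolding l by (simp add: mult_mat_assoc)
  finally have "is_pseudo_inverse A ?X"
    unfolding is_pseudo_inverse_def l r by (auto simp: AXA symAX symZA r intro: carrier_matI)
  then show ?thesis by blast
qed

text \<open>\<open>A * X\<close> and \<open>A * Y\<close> are both the orthogonal projection onto
  the range of \<open>A\<close>, and \<open>X * A\<close> and \<open>Y * A\<close> both the one onto
  the row space; hence \<open>X = X * A * X = X * A * Y = Y * A * Y = Y\<close>.\<close>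

lemma pseudo_inverse_unique:
  assumes X: "is_pseudo_inverse A X" and Y: "is_pseudo_inverse A Y"
  shows "X = Y"
proof -
  have [simp]: "dim_row X = dim_col A" "dim_col X = dim_row A" "dim_row Y = dim_col A" "dim_col Y = dim_row A"
    using X Y by (auto simp: is_pseudo_inverse_def)
  note X' = X[unfolded is_pseudo_inverse_def] and Y' = Y[unfolded is_pseudo_inverse_def]
  \<comment> \<open>The symmetric matrix \<open>A * X\<close> is its own transpose, into which
    \<open>A = A * Y * A\<close> is inserted; transposing swaps the two projections.\<close>
  have "A * X = transpose_mat (A * Y * A * X)" using X' Y' by simp
  also have "\<dots> = transpose_mat (A * X) * transpose_mat (A * Y)"
    by (simp add: mult_mat_assoc transpose_mult_mat)
  also have "\<dots> = A * X * (A * Y)" using X' Y' by (metis (no_types))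
  also have "\<dots> = A * X * A * Y" by (simp add: mult_mat_assoc)
  also have "\<dots> = A * Y" using X' by metis
  finally have l: "A * X = A * Y" .
  have "X * A = transpose_mat (X * (A * Y * A))" using X' Y' by simp
  also have "\<dots> = transpose_mat (Y * A) * transpose_mat (X * A)"
    by (simp add: mult_mat_assoc transpose_mult_mat)
  also have "\<dots> = Y * A * (X * A)" using X' Y' by (metis (no_types))
  also have "\<dots> = Y * (A * X * A)" by (simp add: mult_mat_assoc)
  also have "\<dots> = Y * A" using X' by metis
  finally have r: "X * A = Y * A" .
  have "X = X * (A * X)" using X' by (simp add: mult_mat_assoc)
  also have "\<dots> = X * A * Y" unfolding l by (simp add: mult_mat_assoc)
  also have "\<dots> = Y" unfolding r using Y' by simp
  finally show ?thesis .
qed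

lemma pseudo_inverse: "is_pseudo_inverse A (pseudo_inverse A)"
  unfolding pseudo_inverse_def
  by (rule theI') (use pseudo_inverse_exists pseudo_inverse_unique in blast)

section \<open>Singular values and the lower bound on the row space\<close>

text \<open>Squares of singular values are roots of the nonzero characteristic polynomial, and
  squaring is injective on positive reals. Finiteness is what gives \<open>Min\<close> in
  \<open>sigma_min\<close> its meaning.\<close>

lemma positive_singular_values_finite: "finite (positive_singular_values A)"
proof -
  let ?B = "transpose_mat A * A"
  have B: "?B \<in> carrier_mat (dim_col A) (dim_col A)" by (rule carrier_matI) auto
  have "char_poly ?B \<noteq> 0" using degree_monic_char_poly[OF B] by auto
  then have "finite {c. poly (char_poly ?B) c = 0}" by (rule poly_roots_finite)
  then have fin: "finite {c. eigenvalue ?B c}" by (simp add: eigenvalue_root_char_poly[OF B])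
  have "inj_on (\<lambda>s. s\<^sup>2) (positive_singular_values A)"
    by (rule inj_onI) (auto simp: positive_singular_values_def power2_eq_iff)
  moreover have "(\<lambda>s. s\<^sup>2) ` positive_singular_values A \<subseteq> {c. eigenvalue ?B c}"
    by (auto simp: positive_singular_values_def singular_value_def)
  ultimately show ?thesis using fin finite_subset finite_imageD by blast
qed

text \<open>Compactness comes from the product topology on functions from \<open>nat\<close> to
  \<open>real\<close>, where the cube is compact and the coordinates are continuous. In the
  application \<open>P\<close> is the projection onto the row space.\<close>

lemma minimizer_on_unit_vectors:
  fixes A P :: "real mat"
  assumes P: "P \<in> carrier_mat m m" and A: "A \<in> carrier_mat n m"
    and v: "v \<in> carrier_vec m" "P *\<^sub>v v = v" "v \<noteq> 0\<^sub>v m"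
  obtains u where "u \<in> carrier_vec m" "P *\<^sub>v u = u" "vnorm u = 1"
    "\<forall>z\<in>carrier_vec m. P *\<^sub>v z = z \<longrightarrow> vnorm (A *\<^sub>v u) * vnorm z \<le> vnorm (A *\<^sub>v z)"
proof -
  \<comment> \<open>The equations constrain the coordinates below \<open>m\<close> alone; the
    remaining ones range over \<open>{-1..1}\<close>, and a vector is represented by its extension
    by zero.\<close>
  define K :: "(nat \<Rightarrow> real) set" where "K = (\<Pi>\<^sub>E i\<in>UNIV. {-1..1}) \<inter>
     ({g. (\<Sum>i<m. (g i)\<^sup>2) = 1} \<inter> {g. \<forall>i<m. (\<Sum>j<m. P $$ (i, j) * g j) = g i})"
  define F where "F g = sqrt (\<Sum>i<n. (\<Sum>j<m. A $$ (i, j) * g j)\<^sup>2)" for g :: "nat \<Rightarrow> real"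
  define S where "S = {u \<in> carrier_vec m. P *\<^sub>v u = u \<and> vnorm u = 1}"
  have "compactin (product_topology (\<lambda>_::nat. euclidean :: real topology) UNIV) (\<Pi>\<^sub>E i\<in>UNIV. {-1..1})"
    by (simp add: compactin_PiE)
  then have "compact (\<Pi>\<^sub>E i\<in>(UNIV :: nat set). {-1..(1::real)})"
    by (simp add: euclidean_product_topology)
  moreover have "closed ({g :: nat \<Rightarrow> real. (\<Sum>i<m. (g i)\<^sup>2) = 1} \<inter>
      {g. \<forall>i<m. (\<Sum>j<m. P $$ (i, j) * g j) = g i})"
    by (intro closed_Int closed_Collect_eq closed_Collect_all closed_Collect_imp open_Collect_const
        continuous_intros continuous_on_product_coordinates)
  ultimately have compact: "compact K" unfolding K_def by (rule compact_Int_closed)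
  have cont: "continuous_on K F" unfolding F_def
    by (rule continuous_on_subset[of UNIV])
      (intro continuous_intros continuous_on_product_coordinates, simp)
  have F: "F g = vnorm (A *\<^sub>v Matrix.vec m g)" for g
    using A by (simp add: F_def vnorm_eq_L2_set L2_set_def scalar_prod_def atLeast0LessThan)
  have KS: "Matrix.vec m g \<in> S" if "g \<in> K" for g
  proof -
    have fp: "(\<Sum>j<m. P $$ (i, j) * g j) = g i" if "i < m" for i
      using \<open>g \<in> K\<close> that by (simp add: K_def)
    have "P *\<^sub>v Matrix.vec m g = Matrix.vec m g"
      using P fp by (intro eq_vecI) (simp_all add: scalar_prod_def atLeast0LessThan)
    moreover have "vnorm (Matrix.vec m g) = 1"
      using \<open>g \<in> K\<close> by (simp add: K_def vnorm_eq_L2_set L2_set_def)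
    ultimately show ?thesis by (simp add: S_def)
  qed
  have SK: "\<exists>g\<in>K. u = Matrix.vec m g" if u: "u \<in> S" for u
  proof -
    let ?g = "\<lambda>i. if i < m then u $ i else 0"
    have c: "u \<in> carrier_vec m" "P *\<^sub>v u = u" "vnorm u = 1" using u by (auto simp: S_def)
    have d: "dim_vec u = m" using c by simp
    have one: "(\<Sum>i<m. (u $ i)\<^sup>2) = 1" using c by (simp add: vnorm_eq_L2_set L2_set_def)
    \<comment> \<open>No unit vector is lost by restricting to the cube.\<close>
    have "\<bar>u $ i\<bar> \<le> 1" if "i < m" for i
    proof -
      have "(u $ i)\<^sup>2 \<le> (\<Sum>i<m. (u $ i)\<^sup>2)" using that by (intro member_le_sum) auto
      then show ?thesis unfolding one by (simp add: abs_square_le_1)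
    qed
    then have "?g i \<in> {-1..1}" for i by (auto simp: abs_le_iff)
    moreover have "(\<Sum>j<m. P $$ (i, j) * u $ j) = u $ i" if "i < m" for i
    proof -
      have "(P *\<^sub>v u) $ i = u $ i" by (simp only: c(2))
      then show ?thesis using that P d by (simp add: scalar_prod_def atLeast0LessThan)
    qed
    ultimately have "?g \<in> K" using one by (simp add: K_def PiE_UNIV_domain)
    moreover have "u = Matrix.vec m ?g" using d by (intro eq_vecI) auto
    ultimately show ?thesis by blast
  qed
  have normalize: "(1 / vnorm z) \<cdot>\<^sub>v z \<in> S"
    if z: "z \<in> carrier_vec m" "P *\<^sub>v z = z" "z \<noteq> 0\<^sub>v m" for z
  proof -
    have "0 < vnorm z" using z vnorm_nonneg[of z] vnorm_eq_0_iff[of z] by auto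
    then show ?thesis using z by (simp add: S_def mult_mat_vec[OF P z(1)] vnorm_smult)
  qed
  have "K \<noteq> {}" using SK[OF normalize[OF v]] by blast
  then obtain g where g: "g \<in> K" "\<And>h. h \<in> K \<Longrightarrow> F g \<le> F h"
    using continuous_attains_inf[OF compact _ cont] by blast
  let ?u = "Matrix.vec m g"
  have min: "vnorm (A *\<^sub>v ?u) \<le> vnorm (A *\<^sub>v z)" if "z \<in> S" for z
    using SK[OF that] g(2) by (auto simp: F)
  \<comment> \<open>Homogeneity extends the minimum from unit vectors to all fixed vectors of
    \<open>P\<close>.\<close>
  have "vnorm (A *\<^sub>v ?u) * vnorm z \<le> vnorm (A *\<^sub>v z)"
    if z: "z \<in> carrier_vec m" "P *\<^sub>v z = z" for z
  proof (cases "z = 0\<^sub>v m")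
    case False
    then have "0 < vnorm z" using z vnorm_nonneg[of z] vnorm_eq_0_iff[of z] by auto
    then show ?thesis
      using min[OF normalize[OF z False]] by (simp add: mult_mat_vec[OF A z(1)] vnorm_smult field_simps)
  qed (simp add: vnorm_zero_vec vnorm_nonneg)
  then show ?thesis using that[of ?u] KS[OF g(1)] by (simp add: S_def)
qed

text \<open>A minimizer \<open>u\<close> of \<open>\<parallel>A u\<parallel>\<close> over the unit vectors of the row space is an eigenvector of
  \<open>A\<^sup>T A\<close>, because the first variation of \<open>\<parallel>A z\<parallel>\<^sup>2 - \<parallel>A u\<parallel>\<^sup>2 \<parallel>z\<parallel>\<^sup>2\<close> at \<open>u\<close> in the direction of its own
  gradient must vanish.\<close>

lemma sigma_min_le:
  fixes A X :: "real mat"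
  assumes X: "is_pseudo_inverse A X" and v: "v \<in> carrier_vec (dim_col A)" "(X * A) *\<^sub>v v = v"
  shows "sigma_min A * vnorm v \<le> vnorm (A *\<^sub>v v)"
proof (cases "v = 0\<^sub>v (dim_col A)")
  case True
  then show ?thesis by (simp add: vnorm_zero_vec vnorm_nonneg)
next
  case False
  \<comment> \<open>\<open>?P\<close> is the orthogonal projection onto the row space of
    \<open>A\<close>, so being fixed by it means lying there.\<close>
  let ?m = "dim_col A" and ?P = "X * A"
  have Xc: "X \<in> carrier_mat ?m (dim_row A)" and AXA: "A * X * A = A"
    and symP: "transpose_mat ?P = ?P"
    using X by (simp_all add: is_pseudo_inverse_def)
  have P: "?P \<in> carrier_mat ?m ?m" and Ac: "A \<in> carrier_mat (dim_row A) ?m" using Xc by auto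
  obtain u where u: "u \<in> carrier_vec ?m" "?P *\<^sub>v u = u" "vnorm u = 1"
    and min_all: "\<forall>z\<in>carrier_vec ?m. ?P *\<^sub>v z = z \<longrightarrow> vnorm (A *\<^sub>v u) * vnorm z \<le> vnorm (A *\<^sub>v z)"
    by (rule minimizer_on_unit_vectors[OF P Ac v False])
  note min = min_all[rule_format]
  define s where "s = vnorm (A *\<^sub>v u)"
  define Bu where "Bu = transpose_mat A *\<^sub>v (A *\<^sub>v u)"
  \<comment> \<open>Half the gradient at \<open>u\<close> of
    \<open>(vnorm (A z))^2 - s^2 * (vnorm z)^2\<close>; it vanishes exactly when \<open>u\<close>
    satisfies the eigenvector equation.\<close>
  define w where "w = Bu + (- s\<^sup>2) \<cdot>\<^sub>v u"
  have Bu: "Bu \<in> carrier_vec ?m" by (rule carrier_vecI) (simp add: Bu_def)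
  have w: "w \<in> carrier_vec ?m" using Bu u by (simp add: w_def)
  have "?P * transpose_mat A = transpose_mat (A * X * A)"
    using Xc by (subst symP[symmetric]) (simp add: transpose_mult_mat mult_mat_assoc)
  then have PAt: "?P * transpose_mat A = transpose_mat A" by (simp only: AXA)
  have "?P *\<^sub>v Bu = (?P * transpose_mat A) *\<^sub>v (A *\<^sub>v u)"
    unfolding Bu_def using Xc by (intro mult_mat_vec_assoc[symmetric]) auto
  then have PBu: "?P *\<^sub>v Bu = Bu" by (simp only: PAt Bu_def)
  have Pw: "?P *\<^sub>v w = w"
    unfolding w_def using Bu u
    by (simp add: mult_add_distrib_mat_vec[OF P] mult_mat_vec[OF P] PBu u(2) del: assoc_mult_mat_vec)
  \<comment> \<open>Minimality is tested at \<open>u + r w\<close>. The constant terms cancel since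
    \<open>vnorm u = 1\<close>, and so do the terms in \<open>u \<bullet> w\<close>.\<close>
  have key: "0 \<le> 2 * r * (w \<bullet> w) + r\<^sup>2 * ((vnorm (A *\<^sub>v w))\<^sup>2 - s\<^sup>2 * (vnorm w)\<^sup>2)" for r
  proof -
    let ?z = "u + r \<cdot>\<^sub>v w"
    have z: "?z \<in> carrier_vec ?m" "?P *\<^sub>v ?z = ?z"
      using u w by (simp_all add: mult_add_distrib_mat_vec[OF P] mult_mat_vec[OF P] Pw del: assoc_mult_mat_vec)
    have "(s * vnorm ?z)\<^sup>2 \<le> (vnorm (A *\<^sub>v ?z))\<^sup>2"
      using min[OF z] by (intro power_mono) (auto simp: s_def vnorm_nonneg)
    moreover have "A *\<^sub>v ?z = A *\<^sub>v u + r \<cdot>\<^sub>v (A *\<^sub>v w)"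
      using u w by (simp add: mult_add_distrib_mat_vec[OF Ac] mult_mat_vec[OF Ac])
    moreover have "(vnorm ?z)\<^sup>2 = 1 + 2 * r * (u \<bullet> w) + r\<^sup>2 * (vnorm w)\<^sup>2"
      using u w by (simp add: vnorm_power2_add_smult)
    moreover have "(A *\<^sub>v u) \<bullet> (A *\<^sub>v w) = w \<bullet> w + s\<^sup>2 * (u \<bullet> w)"
    proof -
      have "(A *\<^sub>v u) \<bullet> (A *\<^sub>v w) = (A *\<^sub>v w) \<bullet> (A *\<^sub>v u)"
        by (rule comm_scalar_prod[of _ "dim_row A"]) (auto intro!: carrier_vecI)
      also have "\<dots> = w \<bullet> Bu"
        unfolding Bu_def using w by (intro scalar_prod_transpose) (auto intro!: carrier_vecI)
      also have "Bu = w + s\<^sup>2 \<cdot>\<^sub>v u" using Bu u by (intro eq_vecI) (auto simp: w_def)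
      also have "w \<bullet> (w + s\<^sup>2 \<cdot>\<^sub>v u) = w \<bullet> w + s\<^sup>2 * (w \<bullet> u)"
        using w u by (simp add: scalar_prod_add_distrib[of _ ?m])
      also have "w \<bullet> u = u \<bullet> w" by (rule comm_scalar_prod[OF w u(1)])
      finally show ?thesis .
    qed
    ultimately show ?thesis
      by (simp add: vnorm_power2_add_smult power_mult_distrib s_def[symmetric] algebra_simps)
  qed
  define q where "q = (vnorm (A *\<^sub>v w))\<^sup>2 - s\<^sup>2 * (vnorm w)\<^sup>2"
  have "(s * vnorm w)\<^sup>2 \<le> (vnorm (A *\<^sub>v w))\<^sup>2"
    using min[OF w Pw] by (intro power_mono) (auto simp: s_def vnorm_nonneg)
  then have q: "0 \<le> q" by (simp add: q_def power_mult_distrib)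
  have c: "0 \<le> w \<bullet> w" by (metis vnorm_power2 zero_le_power2)
  have "w \<bullet> w = 0"
  proof (rule ccontr)
    assume "w \<bullet> w \<noteq> 0"
    then have pos: "0 < w \<bullet> w" using c by simp
    \<comment> \<open>For the step \<open>r = - e\<close> the linear gain exceeds the quadratic
      cost; the \<open>+ 1\<close> covers the case \<open>q = 0\<close>.\<close>
    define e where "e = w \<bullet> w / (q + 1)"
    have e: "0 < e" "e * (q + 1) = w \<bullet> w" using pos q by (simp_all add: e_def)
    have "2 * e * (w \<bullet> w) \<le> e * (e * q)"
      using key[of "- e", folded q_def] by (simp add: power2_eq_square)
    then have "2 * (w \<bullet> w) \<le> e * q" using e(1) by simp
    also have "\<dots> \<le> e * (q + 1)" using e(1) by simp
    finally show False using e(2) pos by simp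
  qed
  then have "w = 0\<^sub>v ?m" using w vnorm_power2[of w] vnorm_eq_0_iff[of w] by simp
  then have "Bu $ i = s\<^sup>2 * u $ i" if "i < ?m" for i
  proof -
    have "w $ i = 0" using \<open>w = 0\<^sub>v ?m\<close> that by simp
    then show ?thesis using that Bu u by (simp add: w_def)
  qed
  then have eig: "(transpose_mat A * A) *\<^sub>v u = s\<^sup>2 \<cdot>\<^sub>v u"
    using Bu u by (intro eq_vecI) (auto simp: mult_mat_vec_assoc Bu_def[symmetric])
  have "u \<noteq> 0\<^sub>v ?m" using u(3) by (auto simp: vnorm_zero_vec)
  then have "eigenvalue (transpose_mat A * A) (s\<^sup>2)"
    unfolding eigenvalue_def eigenvector_def using u(1) eig by auto
  \<comment> \<open>If \<open>A u = 0\<close>, then \<open>u = X (A u) = 0\<close>, although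
    \<open>u\<close> is a unit vector.\<close>
  moreover have "0 < s"
  proof (rule ccontr)
    assume "\<not> 0 < s"
    then have "A *\<^sub>v u = 0\<^sub>v (dim_row A)"
      using vnorm_nonneg[of "A *\<^sub>v u"] vnorm_eq_0_iff[of "A *\<^sub>v u"] by (simp add: s_def)
    moreover have "u = X *\<^sub>v (A *\<^sub>v u)" using u Xc by (subst mult_mat_vec_assoc[symmetric]) auto
    ultimately have "u = X *\<^sub>v 0\<^sub>v (dim_row A)" by simp
    also have "\<dots> = 0\<^sub>v ?m" using Xc by (intro eq_vecI) auto
    finally show False using \<open>u \<noteq> 0\<^sub>v ?m\<close> by simp
  qed
  ultimately have "s \<in> positive_singular_values A"
    by (simp add: positive_singular_values_def singular_value_def)
  then have "sigma_min A \<le> s"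
    unfolding sigma_min_def using positive_singular_values_finite by (rule Min_le[rotated])
  then have "sigma_min A * vnorm v \<le> s * vnorm v" by (intro mult_right_mono vnorm_nonneg)
  also have "\<dots> \<le> vnorm (A *\<^sub>v v)" unfolding s_def by (rule min[OF v])
  finally show ?thesis .
qed

lemma sigma_min_pos:
  assumes "positive_singular_values A \<noteq> {}"
  shows "0 < sigma_min A"
  using Min_in[OF positive_singular_values_finite assms]
  by (simp add: sigma_min_def positive_singular_values_def)

section \<open>Minimal norm solutions and the norm estimate\<close>

text \<open>Symmetry of \<open>A * X\<close> yields the normal equation for \<open>v\<close>, hence
  the splitting of the residual; symmetry of \<open>X * A\<close>, which fixes \<open>v\<close>,
  yields the splitting of the norm along the kernel.\<close>

lemma pseudo_inverse_solution:
  assumes X: "is_pseudo_inverse A X" and y: "y \<in> carrier_vec (dim_row A)"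
  defines "v \<equiv> X *\<^sub>v y"
  shows "v \<in> carrier_vec (dim_col A)" "(X * A) *\<^sub>v v = v"
    and "\<And>u. u \<in> carrier_vec (dim_col A) \<Longrightarrow>
      (vnorm (A *\<^sub>v u - y))\<^sup>2 = (vnorm (A *\<^sub>v (u - v)))\<^sup>2 + (vnorm (A *\<^sub>v v - y))\<^sup>2"
    and "\<And>u. u \<in> carrier_vec (dim_col A) \<Longrightarrow> A *\<^sub>v (u - v) = 0\<^sub>v (dim_row A) \<Longrightarrow>
      (vnorm u)\<^sup>2 = (vnorm v)\<^sup>2 + (vnorm (u - v))\<^sup>2"
proof -
  have Xc: "X \<in> carrier_mat (dim_col A) (dim_row A)" and AXA: "A * X * A = A" and XAX: "X * A * X = X"
    and symAX: "transpose_mat (A * X) = A * X" and symXA: "transpose_mat (X * A) = X * A"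
    using X by (simp_all add: is_pseudo_inverse_def)
  have Ac: "A \<in> carrier_mat (dim_row A) (dim_col A)" by simp
  have [simp]: "dim_row X = dim_col A" "dim_col X = dim_row A" using Xc by auto
  show v: "v \<in> carrier_vec (dim_col A)" by (rule carrier_vecI) (simp add: v_def)
  have "(X * A) *\<^sub>v v = (X * A * X) *\<^sub>v y"
    unfolding v_def using y by (intro mult_mat_vec_assoc[symmetric]) auto
  then show fp: "(X * A) *\<^sub>v v = v" by (simp only: XAX v_def)
  have Av: "A *\<^sub>v v = (A * X) *\<^sub>v y" unfolding v_def using y by (simp add: mult_mat_vec_assoc)
  have "transpose_mat A * (A * X) = transpose_mat (A * X * A)"
    by (subst symAX[symmetric]) (simp add: transpose_mult_mat)
  then have AtAX: "transpose_mat A * (A * X) = transpose_mat A" by (simp only: AXA)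
  have "transpose_mat A *\<^sub>v (A *\<^sub>v v) = (transpose_mat A * (A * X)) *\<^sub>v y"
    unfolding Av using y by (intro mult_mat_vec_assoc[symmetric]) auto
  then have Ay: "transpose_mat A *\<^sub>v (A *\<^sub>v v) = transpose_mat A *\<^sub>v y" by (simp only: AtAX)
  have Avc: "A *\<^sub>v v \<in> carrier_vec (dim_row A)" by (rule carrier_vecI) simp
  have Atc: "transpose_mat A \<in> carrier_mat (dim_col A) (dim_row A)" by simp
  have normal_eq: "transpose_mat A *\<^sub>v (A *\<^sub>v v - y) = 0\<^sub>v (dim_col A)"
    unfolding mult_minus_distrib_mat_vec[OF Atc Avc y] Ay by (intro eq_vecI) auto
  have res: "A *\<^sub>v v - y \<in> carrier_vec (dim_row A)" by (rule minus_carrier_vec[OF Avc y])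
  show "(vnorm (A *\<^sub>v u - y))\<^sup>2 = (vnorm (A *\<^sub>v (u - v)))\<^sup>2 + (vnorm (A *\<^sub>v v - y))\<^sup>2"
    if u: "u \<in> carrier_vec (dim_col A)" for u
  proof -
    have "(A *\<^sub>v (u - v)) \<bullet> (A *\<^sub>v v - y) = (u - v) \<bullet> (transpose_mat A *\<^sub>v (A *\<^sub>v v - y))"
      by (rule scalar_prod_transpose[OF minus_carrier_vec[OF u v] res])
    also have "\<dots> = 0" unfolding normal_eq using u v by simp
    finally have orth: "(A *\<^sub>v (u - v)) \<bullet> (A *\<^sub>v v - y) = 0" .
    have "A *\<^sub>v u - y = A *\<^sub>v (u - v) + (A *\<^sub>v v - y)"
      using u v y by (intro eq_vecI) (auto simp: mult_minus_distrib_mat_vec[OF Ac])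
    moreover have "dim_vec (A *\<^sub>v (u - v)) = dim_vec (A *\<^sub>v v - y)" using y by simp
    ultimately show ?thesis by (simp only: vnorm_power2_add_orthogonal[OF _ orth])
  qed
  show "(vnorm u)\<^sup>2 = (vnorm v)\<^sup>2 + (vnorm (u - v))\<^sup>2"
    if u: "u \<in> carrier_vec (dim_col A)" and ker: "A *\<^sub>v (u - v) = 0\<^sub>v (dim_row A)" for u
  proof -
    \<comment> \<open>The projection fixes \<open>v\<close>; moved to the other factor, it
      annihilates the kernel vector \<open>u - v\<close>.\<close>
    have "v \<bullet> (u - v) = ((X * A) *\<^sub>v v) \<bullet> (u - v)" by (simp only: fp)
    also have "\<dots> = v \<bullet> (transpose_mat (X * A) *\<^sub>v (u - v))"
      by (rule scalar_prod_transpose) (use u v in simp_all)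
    also have "\<dots> = v \<bullet> (X *\<^sub>v (A *\<^sub>v (u - v)))"
      unfolding symXA using u v by (subst mult_mat_vec_assoc) auto
    also have "X *\<^sub>v (A *\<^sub>v (u - v)) = 0\<^sub>v (dim_col A)" unfolding ker using Xc by (intro eq_vecI) auto
    also have "v \<bullet> 0\<^sub>v (dim_col A) = 0" using v by simp
    finally have orth: "v \<bullet> (u - v) = 0" .
    have "u = v + (u - v)" using u v by (intro eq_vecI) auto
    then have "(vnorm u)\<^sup>2 = (vnorm (v + (u - v)))\<^sup>2" by simp
    also have "\<dots> = (vnorm v)\<^sup>2 + (vnorm (u - v))\<^sup>2"
      using u v by (intro vnorm_power2_add_orthogonal orth) auto
    finally show ?thesis .
  qed
qed

text \<open>By the residual splitting \<open>X y\<close> is a minimizer and any other one differs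
  from it by a nonzero kernel vector, which strictly increases the norm.\<close>

lemma pseudo_inverse_minimal_norm_least_squares:
  assumes X: "is_pseudo_inverse A X" and y: "y \<in> carrier_vec (dim_row A)"
  shows "minimal_norm_element (least_squares_solutions A y) (X *\<^sub>v y)"
proof -
  let ?v = "X *\<^sub>v y"
  note ps = pseudo_inverse_solution[OF X y]
  have "vnorm (A *\<^sub>v ?v - y) \<le> vnorm (A *\<^sub>v u - y)" if "u \<in> carrier_vec (dim_col A)" for u
    by (rule power2_le_imp_le[OF _ vnorm_nonneg]) (use ps(3)[OF that] in simp)
  then have "?v \<in> least_squares_solutions A y"
    using ps(1) by (simp add: least_squares_solutions_def)
  moreover have "vnorm ?v < vnorm u" if u: "u \<in> least_squares_solutions A y" "u \<noteq> ?v" for u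
  proof -
    have c: "u \<in> carrier_vec (dim_col A)" using u by (simp add: least_squares_solutions_def)
    have "vnorm (A *\<^sub>v u - y) \<le> vnorm (A *\<^sub>v ?v - y)"
      using u ps(1) by (simp add: least_squares_solutions_def)
    then have "(vnorm (A *\<^sub>v u - y))\<^sup>2 \<le> (vnorm (A *\<^sub>v ?v - y))\<^sup>2"
      by (intro power_mono vnorm_nonneg)
    then have "vnorm (A *\<^sub>v (u - ?v)) = 0" using ps(3)[OF c] by simp
    then have "A *\<^sub>v (u - ?v) = 0\<^sub>v (dim_row A)" by (simp add: vnorm_eq_0_iff)
    from ps(4)[OF c this] have "(vnorm u)\<^sup>2 = (vnorm ?v)\<^sup>2 + (vnorm (u - ?v))\<^sup>2" .
    moreover have "vnorm (u - ?v) \<noteq> 0" using u(2) vnorm_minus_eq_0_iff[OF c ps(1)] by simp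
    ultimately have "(vnorm ?v)\<^sup>2 < (vnorm u)\<^sup>2" by simp
    then show ?thesis by (rule power2_less_imp_less[OF _ vnorm_nonneg])
  qed
  ultimately show ?thesis by (simp add: minimal_norm_element_def)
qed

text \<open>When the system is solvable the least residual is zero, so minimality of the norm
  carries over to exact solutions.\<close>

lemma least_squares_solutions_eq_solutions:
  assumes y: "y \<in> carrier_vec (dim_row A)" and "solutions A y \<noteq> {}"
  shows "least_squares_solutions A y = solutions A y"
proof -
  obtain u where u: "u \<in> carrier_vec (dim_col A)" "A *\<^sub>v u = y"
    using assms(2) by (auto simp: solutions_def)
  have zero: "vnorm (A *\<^sub>v w - y) = 0 \<longleftrightarrow> A *\<^sub>v w = y" for w
    by (rule vnorm_minus_eq_0_iff[OF carrier_vecI y]) simp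
  show ?thesis
  proof (intro equalityI subsetI)
    fix w assume w: "w \<in> least_squares_solutions A y"
    then have "vnorm (A *\<^sub>v w - y) \<le> vnorm (A *\<^sub>v u - y)"
      using u(1) by (simp add: least_squares_solutions_def)
    also have "\<dots> = 0" by (rule iffD2[OF zero u(2)])
    finally have "vnorm (A *\<^sub>v w - y) = 0" using vnorm_nonneg by (simp add: order_antisym)
    then show "w \<in> solutions A y"
      using w by (simp add: zero solutions_def least_squares_solutions_def)
  next
    fix w assume "w \<in> solutions A y"
    then show "w \<in> least_squares_solutions A y"
      using zero[of w] by (simp add: solutions_def least_squares_solutions_def vnorm_nonneg)
  qed
qed

text \<open>The residual splitting at \<open>u = 0\<close> gives
  \<open>vnorm (A v) \<le> vnorm y\<close> for \<open>v = X y\<close>, and \<open>v\<close> lies in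
  the row space, where \<open>sigma_min_le\<close> applies.\<close>

lemma pseudo_inverse_norm_bound:
  assumes X: "is_pseudo_inverse A X" and y: "y \<in> carrier_vec (dim_row A)"
    and sv: "positive_singular_values A \<noteq> {}"
  shows "vnorm (X *\<^sub>v y) \<le> 1 / sigma_min A * vnorm y"
proof -
  let ?v = "X *\<^sub>v y"
  note ps = pseudo_inverse_solution[OF X y]
  have "A *\<^sub>v 0\<^sub>v (dim_col A) - y = (-1) \<cdot>\<^sub>v y" using y by (intro eq_vecI) auto
  then have "vnorm (A *\<^sub>v 0\<^sub>v (dim_col A) - y) = vnorm y" by (simp only: vnorm_smult)
  moreover have "A *\<^sub>v (0\<^sub>v (dim_col A) - ?v) = (-1) \<cdot>\<^sub>v (A *\<^sub>v ?v)"
  proof -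
    have "0\<^sub>v (dim_col A) - ?v = (-1) \<cdot>\<^sub>v ?v" using ps(1) by (intro eq_vecI) auto
    then show ?thesis using mult_mat_vec[of A _ _ ?v "-1"] ps(1) by (metis carrier_matI)
  qed
  then have "vnorm (A *\<^sub>v (0\<^sub>v (dim_col A) - ?v)) = vnorm (A *\<^sub>v ?v)" by (simp only: vnorm_smult)
  ultimately have "(vnorm y)\<^sup>2 = (vnorm (A *\<^sub>v ?v))\<^sup>2 + (vnorm (A *\<^sub>v ?v - y))\<^sup>2"
    using ps(3)[of "0\<^sub>v (dim_col A)"] by simp
  then have "(vnorm (A *\<^sub>v ?v))\<^sup>2 \<le> (vnorm y)\<^sup>2" by simp
  then have "vnorm (A *\<^sub>v ?v) \<le> vnorm y" by (rule power2_le_imp_le[OF _ vnorm_nonneg])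
  then have "sigma_min A * vnorm ?v \<le> vnorm y" using sigma_min_le[OF X ps(1,2)] by simp
  then show ?thesis using sigma_min_pos[OF sv] by (simp add: field_simps)
qed

section \<open>Application to the backward end-point mapping\<close>

theorem proposition2:
  fixes f :: "real \<times> (real^'n) \<times> (real^'m) \<Rightarrow> real^'n"
    and a b u0 :: "real^'m" and idx :: "nat \<Rightarrow> 'm"
    and N :: nat and Tbar :: "real vec"
    and tf t :: real and xf :: "real^'n"
    and xbar xper \<delta>x :: "real \<Rightarrow> real^'n"
  assumes "smooth f"
    and "\<forall>i. vec_nth a i \<le> vec_nth b i"
    and "\<forall>i. vec_nth u0 i \<in> {vec_nth a i, vec_nth b i}"
    and "switching_times tf N Tbar"
    and "ode_solution (\<lambda>s z. f (s, z, bang_bang_control a b u0 idx Tbar s)) tf xbar"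
    and "xbar tf = xf"
    and "t \<in> {0..tf}"
    and "xper t = xbar t + \<delta>x t"
  shows "let D = d_backward_endpoint f a b u0 idx tf xf t Tbar;
             \<delta>T = pseudo_inverse D *\<^sub>v coords (\<delta>x t)
         in D \<in> carrier_mat CARD('n) (N - first_after t Tbar) \<and>
            (solutions D (coords (\<delta>x t)) \<noteq> {} \<longrightarrow>
               minimal_norm_element (solutions D (coords (\<delta>x t))) \<delta>T) \<and>
            minimal_norm_element (least_squares_solutions D (coords (\<delta>x t))) \<delta>T \<and>
            (positive_singular_values D \<noteq> {} \<longrightarrow>
               vnorm \<delta>T \<le> 1 / sigma_min D * norm (\<delta>x t))"
proof -
  define D where "D = d_backward_endpoint f a b u0 idx tf xf t Tbar"
  define y where "y = coords (\<delta>x t)"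
  have "dim_vec Tbar = N" using assms(4) by (auto simp: switching_times_def)
  \<comment> \<open>The differential is taken at a zero vector with one entry for each switching
    time later than \<open>t\<close>, which fixes the number of columns.\<close>
  then have D: "D \<in> carrier_mat CARD('n) (N - first_after t Tbar)"
    unfolding D_def d_backward_endpoint_def using differential_carrier by fastforce
  have y: "y \<in> carrier_vec (dim_row D)" using D coords_carrier[of "\<delta>x t"] by (simp add: y_def)
  note X = pseudo_inverse[of D]
  note least = pseudo_inverse_minimal_norm_least_squares[OF X y]
  have "minimal_norm_element (solutions D y) (pseudo_inverse D *\<^sub>v y)" if "solutions D y \<noteq> {}"
    using least least_squares_solutions_eq_solutions[OF y that] by simp
  moreover have "vnorm (pseudo_inverse D *\<^sub>v y) \<le> 1 / sigma_min D * norm (\<delta>x t)"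
    if "positive_singular_values D \<noteq> {}"
    using pseudo_inverse_norm_bound[OF X y that] by (simp add: y_def vnorm_coords)
  ultimately show ?thesis
    unfolding Let_def D_def[symmetric] y_def[symmetric] using D least by blast
qed

end
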